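(* Let $k \ge 4$ be an integer and $n$ an integer. There exists a primitive uniquely $K_{n-1}^{(k)}$-saturated $k$-uniform hypergraph on $n$ vertices if and only if $k+2 \le n \le \frac{(k+2)^2}{4}$.
   Context: $K_r^{(k)}$ denotes the complete $k$-uniform hypergraph on $r$ vertices. A $k$-uniform hypergraph $H$ is uniquely $K_r^{(k)}$-saturated if $H$ contains no copy of $K_r^{(k)}$ (i.e., no $r$-set of vertices all of whose $k$-subsets are edges), and for every $k$-subset $S$ of $V(H)$ that is not an edge of $H$, the hypergraph $H+S$ contains exactly one copy of $K_r^{(k)}$. A vertex $v$ is dominating in $H$ if every $k$-subset of $V(H)$ containing $v$ is an edge of $H$. $H$ is primitive uniquely $K_r^{(k)}$-saturated if it is uniquely $K_r^{(k)}$-saturated and has no dominating vertex. (Here $r = n-1$ and the standing convention $k < r < n$ is in force.) *)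

theory Defs
  imports Complex_Main "HOL-Library.Ramsey"
begin

(* A hypergraph is given by its vertex set V and edge set E.
   From HOL-Library.Ramsey, nsets X m is the set of all m-element subsets of X. *)

definition uniform_hypergraph :: "nat \<Rightarrow> 'a set \<Rightarrow> 'a set set \<Rightarrow> bool" where
  "uniform_hypergraph k V E \<longleftrightarrow> finite V \<and> E \<subseteq> nsets V k"

(* Copies of the complete k-uniform hypergraph on r vertices are identified with
   their vertex sets, since the vertex set determines the copy. *)
definition clique_copies :: "nat \<Rightarrow> nat \<Rightarrow> 'a set \<Rightarrow> 'a set set \<Rightarrow> 'a set set" where
  "clique_copies k r V E = {R \<in> nsets V r. nsets R k \<subseteq> E}"

definition uniquely_saturated :: "nat \<Rightarrow> nat \<Rightarrow> 'a set \<Rightarrow> 'a set set \<Rightarrow> bool" where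
  "uniquely_saturated k r V E \<longleftrightarrow>
     uniform_hypergraph k V E \<and>
     clique_copies k r V E = {} \<and>
     (\<forall>S \<in> nsets V k - E. \<exists>!R. R \<in> clique_copies k r V (insert S E))"

definition dominating :: "nat \<Rightarrow> 'a set \<Rightarrow> 'a set set \<Rightarrow> 'a \<Rightarrow> bool" where
  "dominating k V E v \<longleftrightarrow> v \<in> V \<and> (\<forall>S \<in> nsets V k. v \<in> S \<longrightarrow> S \<in> E)"

definition primitive_uniquely_saturated :: "nat \<Rightarrow> nat \<Rightarrow> 'a set \<Rightarrow> 'a set set \<Rightarrow> bool" where
  "primitive_uniquely_saturated k r V E \<longleftrightarrow>
     uniquely_saturated k r V E \<and> \<not> (\<exists>v. dominating k V E v)"

end

(* A set of n - 1 vertices omits a single vertex v, and it spans a clique iff v lies in every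
   non-edge. So unique saturation says that the non-edges have no common vertex, but that deleting
   any non-edge S from the family leaves exactly one common vertex p(S).
   If there are m non-edges, each S contains all the m vertices p(T) except p(S), hence k + 1 - m
   further vertices. Primitivity makes these cover the remaining n - m vertices, so
   n \<le> m (k + 2 - m) \<le> (k + 2)^2 / 4.
   Conversely, choose the largest m \<le> k with n \<le> m (k + 2 - m) and distribute m blocks of size
   k + 1 - m cyclically over n - m points; every point is then covered by at least one and missed by
   at least two blocks. *)
theory Submission
  imports Defs
begin

section \<open>Unique saturation expressed through non-edges\<close>

lemma nsets_card_minus_one_iff:
  assumes "finite V" "V \<noteq> {}"
  shows "R \<in> nsets V (card V - 1) \<longleftrightarrow> (\<exists>v\<in>V. R = V - {v})"
proof
  assume "R \<in> nsets V (card V - 1)"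
  then have R: "R \<subseteq> V" "card R = card V - 1" "finite R"
    by (auto simp: nsets_def)
  have "card V > 0"
    using assms by (simp add: card_gt_0_iff)
  then have "card (V - R) = 1"
    using R by (simp add: card_Diff_subset)
  then obtain v where "V - R = {v}"
    by (auto simp: card_1_singleton_iff)
  then show "\<exists>v\<in>V. R = V - {v}"
    using R(1) by blast
qed (use assms in \<open>auto simp: nsets_def\<close>)

lemma clique_copies_delete_vertex_iff:
  assumes "finite V" "v \<in> V"
  shows "V - {v} \<in> clique_copies k (card V - 1) V E \<longleftrightarrow> (\<forall>S \<in> nsets V k - E. v \<in> S)"
proof -
  have "V - {v} \<in> nsets V (card V - 1)"
    using assms nsets_card_minus_one_iff by blast
  then show ?thesis
    unfolding clique_copies_def by (auto simp: nsets_def)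
qed

lemma clique_copies_card_minus_one:
  assumes "finite V" "V \<noteq> {}"
  shows "clique_copies k (card V - 1) V E =
           (\<lambda>v. V - {v}) ` {v \<in> V. \<forall>S \<in> nsets V k - E. v \<in> S}" (is "?L = ?R")
proof
  show "?L \<subseteq> ?R"
  proof
    fix R assume R: "R \<in> ?L"
    then obtain v where "v \<in> V" "R = V - {v}"
      using nsets_card_minus_one_iff[OF assms] by (auto simp: clique_copies_def)
    then show "R \<in> ?R"
      using R clique_copies_delete_vertex_iff[OF assms(1)] by blast
  qed
  show "?R \<subseteq> ?L"
    using clique_copies_delete_vertex_iff[OF assms(1)] by blast
qed

lemma uniquely_saturated_card_minus_one_iff:
  assumes "finite V" "V \<noteq> {}" "E \<subseteq> nsets V k"
  shows "uniquely_saturated k (card V - 1) V E \<longleftrightarrow>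
           (\<forall>v\<in>V. \<exists>S \<in> nsets V k - E. v \<notin> S) \<and>
           (\<forall>S \<in> nsets V k - E. \<exists>!v. v \<in> V \<and> (\<forall>T \<in> nsets V k - E - {S}. v \<in> T))"
proof -
  have "(\<exists>!R. R \<in> (\<lambda>v. V - {v}) ` {v \<in> V. Q v}) \<longleftrightarrow> (\<exists>!v. v \<in> V \<and> Q v)" for Q
  proof -
    \<comment> \<open>Deleting different vertices leaves different sets, so a unique clique amounts
      to a unique common vertex. The detour through \<open>is_singleton\<close> turns unique
      existence into a cardinality, which injective images preserve.\<close>
    have "inj_on (\<lambda>v. V - {v}) {v \<in> V. Q v}"
      by (auto simp: inj_on_def)
    then have "is_singleton ((\<lambda>v. V - {v}) ` {v \<in> V. Q v}) \<longleftrightarrow> is_singleton {v \<in> V. Q v}"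
      by (simp add: is_singleton_altdef card_image)
    then show ?thesis
      by (simp only: is_singleton_iff_ex1 mem_Collect_eq)
  qed
  moreover have "nsets V k - insert S E = nsets V k - E - {S}" for S
    by blast
  ultimately show ?thesis
    using assms
    unfolding uniquely_saturated_def uniform_hypergraph_def clique_copies_card_minus_one[OF assms(1,2)]
    by auto
qed

section \<open>Upper bound on the number of vertices\<close>

lemma card_le_of_unique_common_vertices:
  fixes M :: "'a set set"
  assumes fin: "finite V" and M: "M \<subseteq> nsets V k"
    and no_common: "\<And>v. v \<in> V \<Longrightarrow> \<exists>S\<in>M. v \<notin> S"
    and common: "\<And>S. S \<in> M \<Longrightarrow> \<exists>v\<in>V. \<forall>T\<in>M - {S}. v \<in> T"
    and cover: "V \<subseteq> \<Union>M"
  shows "int (card V) \<le> int (card M) * (int k + 2 - int (card M))"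
proof -
  obtain p where p: "\<And>S. S \<in> M \<Longrightarrow> p S \<in> V" "\<And>S T. S \<in> M \<Longrightarrow> T \<in> M \<Longrightarrow> T \<noteq> S \<Longrightarrow> p S \<in> T"
    using common by (metis Diff_iff singletonD)
  \<comment> \<open>\<open>p S\<close> lies in every other member of \<open>M\<close>, so the member
    that avoids it can only be \<open>S\<close>.\<close>
  have p_notin: "p S \<notin> S" if "S \<in> M" for S
    using no_common[OF p(1)[OF that]] p(2)[OF that] by blast
  then have inj: "inj_on p M"
    using p(2) unfolding inj_on_def by metis
  have finM: "finite M"
    using M fin finite_imp_finite_nsets finite_subset by blast
  let ?P = "p ` M"
  have cardP: "card ?P = card M"
    using inj by (rule card_image)
  \<comment> \<open>\<open>S\<close> meets \<open>?P\<close> in all points but \<open>p S\<close>,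
    that is, in \<open>card M - 1\<close> points. The additive form also shows that
    \<open>card M\<close> is at most k + 1, so the passage to integers below loses nothing to
    truncated subtraction.\<close>
  have "card (S - ?P) + card M = k + 1" if S: "S \<in> M" for S
  proof -
    have S': "finite S" "card S = k"
      using M S by (auto simp: nsets_def)
    have "S \<inter> ?P = ?P - {p S}"
      using p(2) p_notin S by blast
    then have "card (S \<inter> ?P) = card M - 1"
      using S cardP finM by simp
    moreover have "card M > 0"
      using S finM by (auto simp: card_gt_0_iff)
    moreover have "card S = card (S \<inter> ?P) + card (S - ?P)"
      using card_Un_disjoint[of "S \<inter> ?P" "S - ?P"] S'(1) by (simp add: Int_Diff_disjoint Int_Diff_Un)
    ultimately show ?thesis
      using S'(2) by simp
  qed
  then have size: "int (card (S - ?P)) = int k + 1 - int (card M)" if "S \<in> M" for S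
    using that by fastforce
  have "?P \<subseteq> V"
    using p(1) by blast
  then have "card V - card M = card (V - ?P)"
    using fin cardP finite_subset by (metis card_Diff_subset)
  also have "\<dots> \<le> card (\<Union>S\<in>M. S - ?P)"
    using cover finM M by (intro card_mono) (auto simp: nsets_def)
  also have "\<dots> \<le> (\<Sum>S\<in>M. card (S - ?P))"
    by (rule card_UN_le[OF finM])
  finally have "int (card V) - int (card M) \<le> (\<Sum>S\<in>M. int (card (S - ?P)))"
    by (simp flip: of_nat_sum)
  also have "\<dots> = int (card M) * (int k + 1 - int (card M))"
    using size by simp
  finally show ?thesis
    by (simp add: algebra_simps)
qed

section \<open>Cyclic blocks and the construction for the converse\<close>

definition cyclic_block :: "nat \<Rightarrow> nat \<Rightarrow> nat \<Rightarrow> nat set" where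
  "cyclic_block N a i = (\<lambda>t. t mod N) ` {i * a..<i * a + a}"

lemma card_cyclic_block:
  assumes "a \<le> N"
  shows "card (cyclic_block N a i) = a"
proof -
  have False if st: "s < t" "s \<ge> i * a" "t < i * a + a" "s mod N = t mod N" for s t
  proof -
    have "N dvd t - s"
      using mod_eq_dvd_iff_nat[of s t N] st by simp
    then show False
      using st assms dvd_imp_le[of N "t - s"] by simp
  qed
  then have "inj_on (\<lambda>t. t mod N) {i * a..<i * a + a}"
    by (intro linorder_inj_onI) fastforce+
  then show ?thesis
    unfolding cyclic_block_def by (simp add: card_image)
qed

text \<open>Before reduction modulo N the intervals tile the numbers below m * a, and w < N is its
  own residue; the interval containing w therefore serves.\<close>

lemma mem_cyclic_block_cover:
  assumes "w < N" "N \<le> m * a"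
  shows "\<exists>i<m. w \<in> cyclic_block N a i"
proof (intro exI conjI)
  have "w < m * a" "a > 0"
    using assms by (auto intro: gr0I)
  then show "w div a < m"
    by (simp add: less_mult_imp_div_less)
  have "w \<in> {w div a * a..<w div a * a + a}"
    using \<open>a > 0\<close> by (simp add: dividend_less_div_times add.commute)
  moreover have "w = w mod N"
    using assms by simp
  ultimately show "w \<in> cyclic_block N a (w div a)"
    unfolding cyclic_block_def by blast
qed

text \<open>Each block containing w comes from some t < m * a with residue w, and
  \<open>t div a\<close> recovers its index. Such a t is determined by \<open>t div N\<close>, which
  is below c because m * a \<le> c * N.\<close>

lemma card_cyclic_block_containing:
  assumes "m * a \<le> c * N"
  shows "card {i. i < m \<and> w \<in> cyclic_block N a i} \<le> c"
proof -
  let ?T = "{t. t < m * a \<and> t mod N = w}"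
  have "{i. i < m \<and> w \<in> cyclic_block N a i} \<subseteq> (\<lambda>t. t div a) ` ?T"
  proof clarify
    fix i assume i: "i < m" "w \<in> cyclic_block N a i"
    then obtain t where t: "i * a \<le> t" "t < i * a + a" "t mod N = w"
      by (auto simp: cyclic_block_def)
    have "Suc i * a \<le> m * a"
      using i(1) by (intro mult_le_mono1) simp
    then have "t < m * a"
      using t(2) by simp
    moreover have "t div a = i"
      using t by (intro div_nat_eqI) (auto simp: algebra_simps)
    ultimately show "i \<in> (\<lambda>t. t div a) ` ?T"
      using t(3) by blast
  qed
  then have "card {i. i < m \<and> w \<in> cyclic_block N a i} \<le> card ?T"
    by (rule surj_card_le[rotated]) simp
  also have "\<dots> \<le> card {..<c}"
  proof (rule card_inj_on_le)
    show "inj_on (\<lambda>t. t div N) ?T"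
      by (rule inj_onI) (metis (mono_tags, lifting) div_mult_mod_eq mem_Collect_eq)
    show "(\<lambda>t. t div N) ` ?T \<subseteq> {..<c}"
      using assms by (auto intro!: less_mult_imp_div_less)
  qed simp
  finally show ?thesis
    by simp
qed

text \<open>The last inequality bounds the total length of m blocks of size k + 1 - m, so that no
  point of the cycle lies in more than m - 2 of them.\<close>

lemma obtain_number_of_nonedges:
  fixes k n :: nat
  assumes "k \<ge> 4" "k + 2 \<le> n" and n: "real n \<le> (real k + 2)\<^sup>2 / 4"
  obtains m where "3 \<le> m" "m \<le> k" "n \<le> m * (k + 2 - m)" "m * (k + 1 - m) \<le> (m - 2) * (n - m)"
proof -
  let ?Q = "\<lambda>m. m \<le> k \<and> n \<le> m * (k + 2 - m)"
  let ?h = "(k + 2) div 2"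
  have "real (4 * n) \<le> real ((k + 2)\<^sup>2)"
    using n by (simp add: field_simps)
  then have n4: "4 * n \<le> (k + 2)\<^sup>2"
    by (simp only: of_nat_le_iff)
  \<comment> \<open>At \<open>?h\<close> the product m * (k + 2 - m) attains its maximum, the
    integer part of (k + 2)^2 / 4. For odd k the integrality of n absorbs the remaining 1/4.\<close>
  have h: "?Q ?h"
  proof (cases "even k")
    case True
    then obtain j where "k = 2 * j" by blast
    then show ?thesis
      using n4 assms(1) by (simp add: power2_eq_square algebra_simps)
  next
    case False
    then obtain j where "k = 2 * j + 1" by (auto elim: oddE)
    then show ?thesis
      using n4 assms(1) by (simp add: power2_eq_square algebra_simps)
  qed
  define m where "m = Greatest ?Q"
  have m: "?Q m"
    unfolding m_def by (rule GreatestI_nat[where P = ?Q and b = k, OF h]) simp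
  have "?h \<le> m"
    unfolding m_def by (rule Greatest_le_nat[where P = ?Q and b = k, OF h]) simp
  then have m3: "3 \<le> m"
    using assms(1) by linarith
  have "m * (k + 1 - m) \<le> (m - 2) * (n - m)"
  proof (cases "m = k")
    case True
    \<comment> \<open>The blocks are single points here, and k \<le> 2 * (k - 2) is exactly k \<ge>
      4.\<close>
    have "m * (k + 1 - m) \<le> (m - 2) * 2"
      using True assms(1) by simp
    also have "\<dots> \<le> (m - 2) * (n - m)"
      using assms(2) True by (intro mult_le_mono2) simp
    finally show ?thesis .
  next
    case False
    \<comment> \<open>Maximality of m makes n, and with it the cycle length n - m, large
      enough.\<close>
    have "\<not> ?Q (Suc m)"
      using Greatest_le_nat[where P = ?Q and b = k, of "Suc m"] unfolding m_def[symmetric] by auto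
    then have gt: "Suc m * (k + 2 - Suc m) < n"
      using m False by auto
    obtain a where a: "k + 1 = m + 2 + a"
      using m False by (metis Suc_eq_plus1 Suc_leI add_2_eq_Suc' add_Suc le_add_diff_inverse order_le_neq_trans)
    obtain b where b: "m = 3 + b"
      using m3 le_Suc_ex by blast
    have "(m + 1) * (a + 2) < n"
      using gt a by simp
    then have "m * (a + 2) + a + 3 - m \<le> n - m"
      by (simp add: algebra_simps)
    then have *: "(m - 2) * (m * (a + 2) + a + 3 - m) \<le> (m - 2) * (n - m)"
      by (rule mult_le_mono2)
    have "k + 1 - m = a + 2"
      using a by simp
    then have "m * (k + 1 - m) \<le> (m - 2) * (m * (a + 2) + a + 3 - m)"
      \<comment> \<open>With m = 3 + b the right side exceeds the left by a + b(4a + 5) + b^2 (a +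
        1).\<close>
      by (simp add: b algebra_simps)
    then show ?thesis
      using * by (rule order_trans)
  qed
  with m m3 that show thesis
    by blast
qed

lemma exists_primitive_uniquely_saturated:
  assumes "3 \<le> m" "m \<le> k" "k < n" "n \<le> m * (k + 2 - m)"
    and upper: "m * (k + 1 - m) \<le> (m - 2) * (n - m)"
  shows "\<exists>E. primitive_uniquely_saturated k (n - 1) {..<n} E"
proof -
  define N where "N = n - m"
  define a where "a = k + 1 - m"
  \<comment> \<open>The vertices below m will be the values of p: \<open>S i\<close> omits only i
    among them. The shifted block adds k + 1 - m vertices to these m - 1, for a total of k.\<close>
  define S where "S = (\<lambda>i. ({..<m} - {i}) \<union> (+) m ` cyclic_block N a i)"
  define M where "M = S ` {..<m}"
  have "a \<le> N" "0 < N"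
    using assms unfolding N_def a_def by auto
  have "N \<le> m * a"
  proof -
    have "k + 2 - m = a + 1"
      using assms unfolding a_def by simp
    then show ?thesis
      using assms unfolding N_def by simp
  qed
  have small_iff: "v \<in> S i \<longleftrightarrow> v \<noteq> i" if "v < m" for v i
    using that by (auto simp: S_def)
  have large_iff: "v \<in> S i \<longleftrightarrow> v - m \<in> cyclic_block N a i" if "m \<le> v" for v i
    using that by (force simp: S_def)
  have S_nsets: "S i \<in> nsets {..<n} k" if "i < m" for i
  proof -
    have "card ((+) m ` cyclic_block N a i) = a"
      by (subst card_image) (auto simp: card_cyclic_block[OF \<open>a \<le> N\<close>])
    moreover have fin: "finite (cyclic_block N a i)"
      by (simp add: cyclic_block_def)
    ultimately have "card (S i) = (m - 1) + a"
      unfolding S_def using that by (subst card_Un_disjoint) auto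
    then have "card (S i) = k"
      using assms unfolding a_def by simp
    moreover have "S i \<subseteq> {..<n}"
    proof -
      have "m + t mod N < n" for t
        using \<open>0 < N\<close> mod_less_divisor[of N t] unfolding N_def by linarith
      then show ?thesis
        using assms unfolding S_def cyclic_block_def by auto
    qed
    moreover have "finite (S i)"
      using fin by (simp add: S_def)
    ultimately show ?thesis
      by (simp add: nsets_def)
  qed
  \<comment> \<open>At most m - 2 of the m blocks contain v - m, so a set missing v remains even
    after \<open>S i\<close> is discarded. This rules out large vertices both as common vertices of
    \<open>M\<close> and as rivals of i once \<open>S i\<close> is removed.\<close>
  have missed_twice: "\<exists>j<m. j \<noteq> i \<and> v \<notin> S j" if "m \<le> v" for v i
  proof (rule ccontr)
    assume "\<not> ?thesis"
    then have "{..<m} - {i} \<subseteq> {j. j < m \<and> v - m \<in> cyclic_block N a j}"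
      using large_iff[OF that] by auto
    then have "card ({..<m} - {i}) \<le> card {j. j < m \<and> v - m \<in> cyclic_block N a j}"
      by (rule card_mono[rotated]) simp
    also have "\<dots> \<le> m - 2"
      using upper unfolding N_def a_def by (rule card_cyclic_block_containing)
    finally show False
      using assms(1) by (simp add: card_Diff_singleton_if split: if_splits)
  qed
  have covered: "\<exists>i<m. v \<in> S i" if "v < n" for v
  proof (cases "v < m")
    case True
    have "\<exists>i<m. v \<noteq> i"
      using assms(1) by (intro exI[of _ "if v = 0 then 1 else 0"]) auto
    then show ?thesis
      using small_iff[OF True] by blast
  next
    case False
    then have "v - m < N"
      using that assms unfolding N_def by simp
    then show ?thesis
      using mem_cyclic_block_cover[OF _ \<open>N \<le> m * a\<close>] large_iff False by (metis not_less)
  qed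
  have inj: "S i = S j \<longleftrightarrow> i = j" if "i < m" "j < m" for i j
    using small_iff[of i i] small_iff[of i j] that by auto
  let ?E = "nsets {..<n} k - M"
  have M: "nsets {..<n} k - ?E = M"
    using S_nsets unfolding M_def by blast
  have "uniquely_saturated k (card {..<n} - 1) {..<n} ?E"
  proof (subst uniquely_saturated_card_minus_one_iff, goal_cases)
    case 4
    show ?case
      unfolding M
    proof (intro conjI ballI)
      show "\<exists>T\<in>M. v \<notin> T" if "v \<in> {..<n}" for v
        using missed_twice[of v] small_iff[of v v] unfolding M_def
        by (cases "v < m") (auto simp: not_less)
      fix T assume "T \<in> M"
      then obtain i where i: "i < m" "T = S i"
        by (auto simp: M_def)
      show "\<exists>!v. v \<in> {..<n} \<and> (\<forall>T'\<in>M - {T}. v \<in> T')"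
      proof (rule ex1I[of _ i])
        show "i \<in> {..<n} \<and> (\<forall>T'\<in>M - {T}. i \<in> T')"
          using i assms small_iff[OF i(1)] by (auto simp: M_def)
        fix v assume v: "v \<in> {..<n} \<and> (\<forall>T'\<in>M - {T}. v \<in> T')"
        then have *: "v \<in> S j" if "j < m" "j \<noteq> i" for j
          using that i inj by (auto simp: M_def)
        \<comment> \<open>A vertex v below m is missing from \<open>S v\<close>, so only v = i
          survives.\<close>
        have "v < m"
          using missed_twice[of v i] * by (meson not_less)
        then show "v = i"
          using * small_iff by blast
      qed
    qed
  qed (use assms in auto)
  moreover have "\<not> dominating k {..<n} ?E v" for v
    using covered S_nsets unfolding dominating_def M_def by blast
  ultimately show ?thesis
    unfolding primitive_uniquely_saturated_def by auto
qed

theorem theorem8: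
  fixes k n :: nat
  assumes "k \<ge> 4"
  shows "(\<exists>(V :: nat set) E. card V = n \<and> k < n - 1 \<and> n - 1 < n \<and>
            primitive_uniquely_saturated k (n - 1) V E)
         \<longleftrightarrow> k + 2 \<le> n \<and> real n \<le> (real k + 2)\<^sup>2 / 4"
proof
  assume "\<exists>(V :: nat set) E. card V = n \<and> k < n - 1 \<and> n - 1 < n \<and>
            primitive_uniquely_saturated k (n - 1) V E"
  then obtain V :: "nat set" and E where n: "card V = n" "k < n - 1"
    and us: "uniquely_saturated k (card V - 1) V E" and nd: "\<And>v. \<not> dominating k V E v"
    unfolding primitive_uniquely_saturated_def by blast
  let ?M = "nsets V k - E"
  have V: "finite V" "V \<noteq> {}" "E \<subseteq> nsets V k"
    using us n unfolding uniquely_saturated_def uniform_hypergraph_def by auto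
  note sat = us[unfolded uniquely_saturated_card_minus_one_iff[OF V]]
  have "int (card V) \<le> int (card ?M) * (int k + 2 - int (card ?M))"
  proof (rule card_le_of_unique_common_vertices[OF V(1)])
    \<comment> \<open>A vertex in no non-edge would be dominating.\<close>
    show "V \<subseteq> \<Union>?M"
      using nd unfolding dominating_def by blast
  qed (use sat in blast)+
  then have "real_of_int (int n) \<le> real_of_int (int (card ?M) * (int k + 2 - int (card ?M)))"
    unfolding n(1) by (simp only: of_int_le_iff)
  then have "real n \<le> real (card ?M) * (real k + 2 - real (card ?M))"
    by simp
  also have "\<dots> \<le> (real k + 2)\<^sup>2 / 4"
    \<comment> \<open>AM-GM for the factors m and k + 2 - m, whose difference is squared
      here.\<close>
    using zero_le_power2[of "real k + 2 - 2 * real (card ?M)"]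
    by (simp add: power2_eq_square algebra_simps)
  finally show "k + 2 \<le> n \<and> real n \<le> (real k + 2)\<^sup>2 / 4"
    using n(2) by simp
next
  assume n: "k + 2 \<le> n \<and> real n \<le> (real k + 2)\<^sup>2 / 4"
  then obtain m where "3 \<le> m" "m \<le> k" "n \<le> m * (k + 2 - m)" "m * (k + 1 - m) \<le> (m - 2) * (n - m)"
    using obtain_number_of_nonedges[OF assms] by blast
  then obtain E where "primitive_uniquely_saturated k (n - 1) {..<n} E"
    using exists_primitive_uniquely_saturated[of m k n] n by auto
  then show "\<exists>(V :: nat set) E. card V = n \<and> k < n - 1 \<and> n - 1 < n \<and>
            primitive_uniquely_saturated k (n - 1) V E"
    using n by (intro exI[of _ "{..<n}"] exI[of _ E]) auto
qed

end
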